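(* Let $\lambda\in\mathbb{R}$. The solution $y$ of the Volterra integral equation of second kind $$y(t)=1-\frac{2\lambda}{\sqrt{\pi}}\int_{0}^{t}y(\tau)\sqrt{t-\tau}\,d\tau,\quad t>0,$$ is given by the expression $$y(t)=I(t)-\sqrt{\frac{2}{\pi}}\,J(t),\quad t>0,$$ with $$I(t)=\sum_{n=0}^{+\infty}\frac{(\lambda^{2/3}t)^{3n}}{(3n)!},\qquad J(t)=\sum_{n=0}^{+\infty}\frac{(2\lambda^{2/3}t)^{\frac{3(2n+1)}{2}}}{(3(2n+1))!!},$$ which are series with infinite radii of convergence.
   Context: The double factorial of an odd positive integer is defined by $(2n+1)!!=(2n+1)(2n-1)(2n-3)\cdots 5\cdot 3\cdot 1$. The number $\lambda$ is a real parameter. *)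

theory Defs
  imports "HOL-Analysis.Analysis"
begin

fun dfact :: "nat \<Rightarrow> nat" where
  "dfact 0 = 1"
| "dfact (Suc 0) = 1"
| "dfact (Suc (Suc n)) = Suc (Suc n) * dfact n"

text \<open>
  The unknown function is real and only its values on the positive half-line matter.  A solution is
  required to make the integral exist as a Lebesgue integral; continuity is not assumed.
\<close>
definition volterra_solution :: "real \<Rightarrow> (real \<Rightarrow> real) \<Rightarrow> bool" where
  "volterra_solution lam y \<longleftrightarrow>
    (\<forall>t>0. (\<lambda>\<tau>. y \<tau> * sqrt (t - \<tau>)) absolutely_integrable_on {0..t} \<and>
           y t = 1 - 2 * lam / sqrt pi * integral {0..t} (\<lambda>\<tau>. y \<tau> * sqrt (t - \<tau>)))"

text \<open>
  Fractional powers are complex principal powers, because negative \<open>lam\<close> is allowed.  For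
  \<open>lam < 0\<close> the number \<open>lam powr (2/3)\<close> then has argument \<open>2*pi/3\<close>, and its power
  with exponent \<open>3*(2*n+1)/2\<close> is \<open>lam ^ (2*n+1)\<close> with the correct (negative) sign.  The
  positive real number \<open>\<bar>lam\<bar> powr (2/3)\<close> would lose this sign.  The powers in \<open>I_term\<close> have
  natural exponents, so that the term for \<open>n = 0\<close> is \<open>1\<close> also when \<open>lam = 0\<close>.
\<close>
definition I_term :: "real \<Rightarrow> real \<Rightarrow> nat \<Rightarrow> complex" where
  "I_term lam t n = (of_real lam powr (2/3) * of_real t) ^ (3 * n) / fact (3 * n)"

definition J_term :: "real \<Rightarrow> real \<Rightarrow> nat \<Rightarrow> complex" where
  "J_term lam t n = (2 * of_real lam powr (2/3) * of_real t) powr (3 * (2 * of_nat n + 1) / 2)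
                  / of_nat (dfact (3 * (2 * n + 1)))"

definition I_series :: "real \<Rightarrow> real \<Rightarrow> complex" where
  "I_series lam t = (\<Sum>n. I_term lam t n)"

definition J_series :: "real \<Rightarrow> real \<Rightarrow> complex" where
  "J_series lam t = (\<Sum>n. J_term lam t n)"

text \<open>
  The series \<open>I\<close> is a power series in \<open>t\<close>, and \<open>J\<close> is a power series in
  the square root of \<open>t\<close>.  The following are their full coefficient sequences, so
  that the radii of convergence can be expressed by \<open>conv_radius\<close>; the two lemmas
  identify the terms.
\<close>
definition I_coeff :: "real \<Rightarrow> nat \<Rightarrow> complex" where
  "I_coeff lam k = (if 3 dvd k then (of_real lam powr (2/3)) ^ k / fact k else 0)"

definition J_coeff :: "real \<Rightarrow> nat \<Rightarrow> complex" where
  "J_coeff lam m = (if odd m \<and> 3 dvd m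
                  then (2 * of_real lam powr (2/3)) powr (of_nat m / 2) / of_nat (dfact m) else 0)"

lemma I_term_eq_coeff: "I_term lam t n = I_coeff lam (3 * n) * of_real t ^ (3 * n)"
  by (simp add: I_term_def I_coeff_def power_mult_distrib)

lemma J_term_eq_coeff:
  assumes "t > 0"
  shows "J_term lam t n = J_coeff lam (3 * (2 * n + 1)) * of_real (sqrt t) ^ (3 * (2 * n + 1))"
proof -
  define m where "m = 3 * (2 * n + 1)"
  have m: "odd m" "3 dvd m" "3 * (2 * of_nat n + 1) / 2 = (of_nat m / 2 :: complex)"
    by (simp_all add: m_def)
  have "(of_real t :: complex) powr (of_nat m / 2) = of_real (t powr (real m / 2))"
    using assms powr_of_real[of t "real m / 2"] by simp
  also have "t powr (real m / 2) = sqrt t ^ m"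
    using assms by (simp add: powr_half_sqrt[symmetric] powr_powr flip: powr_realpow)
  finally have "(2 * of_real lam powr (2/3) * of_real t) powr (of_nat m / 2) =
      (2 * of_real lam powr (2/3)) powr (of_nat m / 2) * (of_real (sqrt t) :: complex) ^ m"
    using assms powr_times_real_left[of "of_real t" "2 * of_real lam powr (2/3)" "of_nat m / 2"]
    by (simp add: mult.commute)
  thus ?thesis
    unfolding J_term_def J_coeff_def m_def[symmetric] m(3) using m(1,2) by simp
qed

end

theory Submission
  imports Defs
begin

text \<open>
  The convolution with \<open>2 / sqrt pi * sqrt t\<close> is the fractional integral of order \<open>3/2\<close>: by the Beta
  integral it maps \<open>t powr a / Gamma (a + 1)\<close> to \<open>t powr (a + 3/2) / Gamma (a + 5/2)\<close>.  Hence the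
  Mittag-Leffler series \<open>\<Sum>k. (- lam) ^ k * t powr (3 * k / 2) / Gamma (3 * k / 2 + 1)\<close> solves the
  equation.  Its terms of even index form \<open>I\<close>, those of odd index form \<open>J\<close>, because
  \<open>Gamma (m / 2 + 1)\<close> is \<open>sqrt (pi / 2) * m!! / 2 powr (m / 2)\<close> for odd \<open>m\<close>.  Uniqueness is a
  Gronwall argument: the kernel is bounded on compact intervals, so the difference of two solutions
  is bounded by \<open>C * (K * t) ^ n / n!\<close> for all \<open>n\<close>.
\<close>

section \<open>Double factorials and the radii of convergence\<close>

lemma dfact_pos: "dfact m > 0"
  by (induction m rule: dfact.induct) auto

text \<open>Passing from \<open>n\<close> to \<open>n + 2\<close> multiplies the left side by
  \<open>(n + 2) * (n + 1)\<close> and the right side by \<open>(n + 2)^2\<close>. So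
  \<open>m!!\<close> grows at least like the square root of \<open>m!\<close>.\<close>

lemma fact_le_dfact_power2: "fact m \<le> (dfact m)\<^sup>2"
proof (induction m rule: dfact.induct)
  case (3 n)
  have "fact (Suc (Suc n)) = Suc (Suc n) * Suc n * (fact n :: nat)"
    by (simp add: algebra_simps)
  also have "\<dots> \<le> Suc (Suc n) * Suc (Suc n) * (dfact n)\<^sup>2"
    using "3.IH" by (intro mult_mono) auto
  finally show ?case
    by (simp only: dfact.simps power2_eq_square mult_ac)
qed auto

text \<open>The bound \<open>m!! \<ge> sqrt (m!)\<close> leaves square roots of exponential terms.
  The inequality \<open>2 * x * y \<le> x^2 + y^2\<close> removes the root. Moving a factor
  \<open>2 ^ m\<close> into \<open>x\<close> makes \<open>y\<close> geometric, so that both squares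
  have summable bounds.\<close>

lemma summable_power_div_dfact:
  fixes r :: real
  assumes "r \<ge> 0"
  shows "summable (\<lambda>m. r ^ m / dfact m)"
proof (rule summable_comparison_test')
  have "summable (\<lambda>m. inverse (fact m) * (4 * r\<^sup>2) ^ m :: real)"
    by (rule summable_exp)
  thus "summable (\<lambda>m. inverse (fact m) * (4 * r\<^sup>2) ^ m + (1 / 4) ^ m :: real)"
    by (intro summable_add summable_geometric) auto
  fix m :: nat
  define x where "x = (2 * r) ^ m / dfact m"
  define y :: real where "y = (1 / 2) ^ m"
  have xy: "r ^ m / dfact m = x * y"
    by (simp add: x_def y_def power_mult_distrib power_one_over)
  have "((2 * r) ^ m)\<^sup>2 = ((2 * r)\<^sup>2) ^ m"
    by (simp only: mult.commute flip: power_mult)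
  hence sq: "((2 * r) ^ m)\<^sup>2 = (4 * r\<^sup>2) ^ m"
    by (simp add: power2_eq_square)
  have "real (fact m) \<le> (real (dfact m))\<^sup>2"
    using fact_le_dfact_power2[of m] by (simp flip: of_nat_power del: of_nat_fact)
  hence "x\<^sup>2 \<le> (4 * r\<^sup>2) ^ m / fact m"
    unfolding x_def using assms dfact_pos[of m]
    by (simp only: power_divide sq) (intro frac_le; simp)
  moreover have "y\<^sup>2 = (1 / 4) ^ m"
    by (simp add: y_def power2_eq_square flip: power_mult_distrib)
  moreover have "2 * (x * y) \<le> x\<^sup>2 + y\<^sup>2"
    using sum_squares_bound[of x y] by simp
  moreover have "x * y \<ge> 0"
    using assms by (simp add: x_def y_def)
  ultimately show "norm (r ^ m / dfact m) \<le> inverse (fact m) * (4 * r\<^sup>2) ^ m + (1 / 4) ^ m"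
    unfolding xy real_norm_def inverse_eq_divide times_divide_eq_left mult_1 by linarith
qed

section \<open>Infinite radii of convergence, and summability of the terms of I and J\<close>

lemma conv_radius_I_coeff: "conv_radius (I_coeff lam) = \<infinity>"
proof (rule conv_radius_inftyI'')
  fix z :: complex
  let ?w = "of_real lam powr (2/3) * z"
  show "summable (\<lambda>k. I_coeff lam k * z ^ k)"
  proof (rule summable_comparison_test')
    show "summable (\<lambda>k. inverse (fact k) * norm ?w ^ k)"
      by (rule summable_exp)
    show "norm (I_coeff lam k * z ^ k) \<le> inverse (fact k) * norm ?w ^ k" for k
      by (simp add: I_coeff_def norm_mult norm_divide norm_power power_mult_distrib inverse_eq_divide)
  qed
qed

lemma conv_radius_J_coeff: "conv_radius (J_coeff lam) = \<infinity>"
proof (rule conv_radius_inftyI'')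
  fix z :: complex
  let ?a = "2 * of_real lam powr (2/3) :: complex"
  let ?r = "norm ?a powr (1/2) * norm z"
  show "summable (\<lambda>m. J_coeff lam m * z ^ m)"
  proof (rule summable_comparison_test')
    show "summable (\<lambda>m. ?r ^ m / dfact m)"
      by (rule summable_power_div_dfact) simp
    fix m :: nat
    \<comment> \<open>The exponent is real, so only the modulus of the base matters. Oddness rules
      out \<open>m = 0\<close>, where \<open>lam = 0\<close> would give \<open>0 powr 0 = 0\<close>
      on the left but \<open>0 ^ 0 = 1\<close> on the right.\<close>
    have "norm (?a powr (of_nat m / 2)) = (norm ?a powr (1/2)) ^ m" if "odd m"
    proof (cases "lam = 0")
      case True
      with that show ?thesis by (cases m) auto
    next
      case False
      thus ?thesis
        by (subst powr_power) (auto simp: norm_powr_complex)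
    qed
    thus "norm (J_coeff lam m * z ^ m) \<le> ?r ^ m / dfact m"
      by (simp add: J_coeff_def norm_mult norm_divide norm_power power_mult_distrib)
  qed
qed

lemma summable_I_term: "summable (I_term lam t)"
proof -
  have "summable (\<lambda>k. I_coeff lam k * of_real t ^ k)"
    by (rule summable_in_conv_radius) (simp add: conv_radius_I_coeff)
  hence "summable (\<lambda>n. I_coeff lam (3 * n) * of_real t ^ (3 * n))"
    by (subst summable_mono_reindex[where g = "\<lambda>n. 3 * n"])
       (auto simp: strict_mono_def I_coeff_def dvd_def)
  thus ?thesis
    by (simp add: I_term_eq_coeff[abs_def])
qed

lemma summable_J_term:
  assumes "t > 0"
  shows "summable (J_term lam t)"
proof -
  have "summable (\<lambda>m. J_coeff lam m * of_real (sqrt t) ^ m)"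
    by (rule summable_in_conv_radius) (simp add: conv_radius_J_coeff)
  \<comment> \<open>The omitted indices carry zero coefficients, so the subsequence and the full
    power series in \<open>sqrt t\<close> are summable together.\<close>
  hence "summable (\<lambda>n. J_coeff lam (3 * (2 * n + 1)) * of_real (sqrt t) ^ (3 * (2 * n + 1)))"
  proof (subst summable_mono_reindex[where g = "\<lambda>n. 3 * (2 * n + 1)"])
    fix m assume "m \<notin> range (\<lambda>n::nat. 3 * (2 * n + 1))"
    moreover have "m \<in> range (\<lambda>n. 3 * (2 * n + 1))" if "odd m" "3 dvd m"
    proof -
      from that(2) obtain k where k: "m = 3 * k"
        by (rule dvdE)
      with that(1) have "odd k"
        by simp
      then obtain n where "k = 2 * n + 1"
        by (rule oddE)
      with k show ?thesis
        by blast
    qed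
    ultimately have "\<not> (odd m \<and> 3 dvd m)"
      by blast
    thus "J_coeff lam m * of_real (sqrt t) ^ m = 0"
      by (auto simp: J_coeff_def)
  qed (auto simp: strict_mono_def)
  thus ?thesis
    by (simp only: J_term_eq_coeff[OF assms, symmetric])
qed

section \<open>The Mittag-Leffler series\<close>

text \<open>The series is the Mittag-Leffler function of order \<open>3/2\<close> at
  \<open>- lam * t^(3/2)\<close>. Natural powers of \<open>sqrt t\<close> make the term for
  \<open>k = 0\<close> equal to \<open>1\<close> also at \<open>t = 0\<close>, where
  \<open>0 powr 0\<close> would be \<open>0\<close>, and keep every term continuous.\<close>

definition ml_term :: "real \<Rightarrow> nat \<Rightarrow> real \<Rightarrow> real" where
  "ml_term lam k t = (- lam) ^ k / Gamma (3 * real k / 2 + 1) * sqrt t ^ (3 * k)"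

definition ml_series :: "real \<Rightarrow> real \<Rightarrow> real" where
  "ml_series lam t = (\<Sum>k. ml_term lam k t)"

section \<open>Gamma at half-integers, and the even and odd terms as terms of I and J\<close>

lemma Gamma_three_halves: "Gamma (3 / 2 :: real) = sqrt pi / 2"
proof -
  have "(1/2 :: real) \<notin> \<int>\<^sub>\<le>\<^sub>0"
    by (auto elim!: nonpos_Ints_cases')
  from Gamma_plus1[OF this] show ?thesis
    by (simp add: Gamma_one_half_real)
qed

text \<open>The functional equation contributes the factor \<open>j + 3/2 = (2 * j + 3) / 2\<close>
  at each step, which is the next odd factor over \<open>2\<close>.\<close>

lemma Gamma_half_odd: "Gamma (real j + 3 / 2) = sqrt pi * dfact (2 * j + 1) / 2 ^ (j + 1)"
proof (induction j)
  case 0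
  thus ?case by (simp add: Gamma_three_halves)
next
  case (Suc j)
  have "real j + 3 / 2 \<notin> \<int>\<^sub>\<le>\<^sub>0"
    by (auto elim!: nonpos_Ints_cases')
  hence "Gamma (real (Suc j) + 3 / 2) = (real j + 3 / 2) * Gamma (real j + 3 / 2)"
    using Gamma_plus1[of "real j + 3 / 2"] by (simp add: add_ac)
  also have "\<dots> = sqrt pi * dfact (2 * Suc j + 1) / 2 ^ (Suc j + 1)"
    unfolding Suc by (simp add: field_simps)
  finally show ?case .
qed

text \<open>Only cubes of \<open>lam powr (2/3)\<close> occur, and these are \<open>lam ^ 2\<close>
  for either sign of \<open>lam\<close>. The even power also removes the sign of
  \<open>- lam\<close>.\<close>

lemma I_term_eq_ml_term:
  assumes "t \<ge> 0"
  shows "I_term lam t n = of_real (ml_term lam (2 * n) t)"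
proof -
  have "(complex_of_real lam powr (2/3)) ^ 3 = of_real lam ^ 2"
  proof (cases "lam = 0")
    case False
    hence "(complex_of_real lam powr (2/3)) ^ 3 = of_real lam powr (of_nat 3 * (2/3))"
      by (subst powr_power) auto
    also have "\<dots> = of_real lam powr of_nat 2"
      by simp
    also have "\<dots> = of_real lam ^ 2"
      by (rule powr_nat') simp
    finally show ?thesis .
  qed simp
  hence "(complex_of_real lam powr (2/3)) ^ (3 * n) = of_real lam ^ (2 * n)"
    by (simp add: power_mult)
  moreover have "sqrt t ^ (3 * (2 * n)) = t ^ (3 * n)"
  proof -
    have "sqrt t ^ (3 * (2 * n)) = ((sqrt t)\<^sup>2) ^ (3 * n)"
      by (simp only: mult.left_commute[of 3 2] power_mult)
    thus ?thesis
      using assms by simp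
  qed
  moreover have "Gamma (3 * real n + 1) = fact (3 * n)"
    using Gamma_fact[of "3 * n", where 'a = real] by (simp add: add.commute)
  ultimately show ?thesis
    by (simp add: I_term_eq_coeff I_coeff_def ml_term_def)
qed

text \<open>Here the branch matters. On the principal branch the exponents may be multiplied, and
  \<open>3 * (2 * n + 1) / 2 * (2/3) = 2 * n + 1\<close> is odd, so the sign of \<open>lam\<close>
  survives. The positive factor \<open>2\<close> can be split off.\<close>

lemma powr_two_thirds_powr:
  "((2 * complex_of_real lam powr (2/3)) powr (of_nat (3 * (2 * n + 1)) / 2))
     = of_real (2 ^ (3 * n + 1) * sqrt 2 * lam ^ (2 * n + 1))"
proof (cases "lam = 0")
  case False
  let ?m = "3 * (2 * n + 1)"
  let ?L = "ln (complex_of_real lam)"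
  have "Im ?L \<in> {0, pi}"
    using False by (cases "lam > 0") (auto simp: Ln_of_real' Ln_of_real Im_Ln_eq_pi)
  \<comment> \<open>The imaginary part of \<open>2/3 * ?L\<close> is \<open>0\<close> or
    \<open>2 * pi / 3\<close>, inside the principal strip.\<close>
  hence "ln (exp (2/3 * ?L)) = 2/3 * ?L"
    using pi_gt_zero by (intro Ln_exp) auto
  hence "(complex_of_real lam powr (2/3)) powr (of_nat ?m / 2) = exp (of_nat ?m / 2 * (2/3 * ?L))"
    using False by (simp only: powr_def) (simp flip: times_divide_eq_right times_divide_eq_left)
  also have "of_nat ?m / 2 * (2/3 * ?L) = of_nat (2 * n + 1) * ?L"
    by (simp add: field_simps)
  also have "exp (of_nat (2 * n + 1) * ?L) = exp ?L ^ (2 * n + 1)"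
    by (rule exp_of_nat_mult)
  also have "\<dots> = of_real lam ^ (2 * n + 1)"
    using False by simp
  finally have 1: "(complex_of_real lam powr (2/3)) powr (of_nat ?m / 2) = of_real lam ^ (2 * n + 1)" .
  have "real ?m / 2 = real (3 * n + 1) + 1 / 2"
    by (simp add: field_simps)
  hence "2 powr (real ?m / 2) = 2 powr real (3 * n + 1) * 2 powr (1 / 2)"
    by (simp only: powr_add)
  hence "2 powr (real ?m / 2) = 2 ^ (3 * n + 1) * sqrt 2"
    by (simp only: powr_realpow powr_half_sqrt zero_less_numeral zero_le_numeral)
  moreover have "(2::complex) powr (of_nat ?m / 2) = of_real (2 powr (real ?m / 2))"
    using powr_of_real[of 2 "real ?m / 2"] by simp
  ultimately show ?thesis
    using 1 powr_times_real_left[of 2 "of_real lam powr (2/3)" "of_nat ?m / 2"]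
    by (simp only: of_real_mult of_real_power) simp
qed simp

text \<open>The Gamma value at \<open>j = 3 * n + 1\<close> supplies the double factorial and
  \<open>1 / sqrt pi\<close>. The factor \<open>sqrt (2 / pi)\<close> arises from
  \<open>2 / sqrt pi = sqrt (2 / pi) * sqrt 2\<close>, and the minus sign from an odd power of
  \<open>- lam\<close>.\<close>

lemma J_term_eq_ml_term:
  assumes "t > 0"
  shows "of_real (sqrt (2 / pi)) * J_term lam t n = - of_real (ml_term lam (2 * n + 1) t)"
proof -
  let ?m = "3 * (2 * n + 1)"
  have m: "2 * (3 * n + 1) + 1 = ?m"
    by simp
  have "3 * real (2 * n + 1) / 2 + 1 = real (3 * n + 1) + 3 / 2"
    by (simp add: field_simps)
  hence "Gamma (3 * real (2 * n + 1) / 2 + 1) = sqrt pi * dfact ?m / 2 ^ (3 * n + 2)"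
    using Gamma_half_odd[of "3 * n + 1"] unfolding m by simp
  hence "- ml_term lam (2 * n + 1) t
           = lam ^ (2 * n + 1) * 2 ^ (3 * n + 2) / (sqrt pi * dfact ?m) * sqrt t ^ ?m"
    unfolding ml_term_def by (simp only: power_minus_odd) simp
  also have "\<dots> = sqrt (2 / pi) * (2 ^ (3 * n + 1) * sqrt 2 * lam ^ (2 * n + 1) / dfact ?m * sqrt t ^ ?m)"
    by (simp add: real_sqrt_divide)
  finally have *: "- ml_term lam (2 * n + 1) t = \<dots>" .
  have "- complex_of_real (ml_term lam (2 * n + 1) t) = of_real (sqrt (2 / pi)) *
      (of_real (2 ^ (3 * n + 1) * sqrt 2 * lam ^ (2 * n + 1)) / of_nat (dfact ?m) * of_real (sqrt t) ^ ?m)"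
    using arg_cong[OF *, of complex_of_real]
    by (simp only: of_real_minus of_real_mult of_real_divide of_real_power of_real_of_nat_eq)
  also have "\<dots> = of_real (sqrt (2 / pi)) * J_term lam t n"
    using powr_two_thirds_powr[of lam n] J_term_eq_coeff[OF assms, of lam n]
    by (simp only: J_coeff_def) auto
  finally show ?thesis by simp
qed

lemma ml_term_sums:
  assumes "t > 0"
  shows "summable (\<lambda>k. ml_term lam k t)"
    and "complex_of_real (ml_series lam t) =
           I_series lam t - complex_of_real (sqrt (2 / pi)) * J_series lam t"
proof -
  let ?c = "complex_of_real (sqrt (2 / pi))"
  have I: "(\<lambda>n. complex_of_real (ml_term lam (2 * n) t)) sums I_series lam t"
    unfolding I_series_def I_term_eq_ml_term[OF less_imp_le[OF assms], symmetric]
    by (intro summable_sums summable_I_term)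
  have "(\<lambda>n. - (?c * J_term lam t n)) sums - (?c * J_series lam t)"
    unfolding J_series_def
    by (intro sums_minus sums_mult summable_sums summable_J_term assms)
  hence J: "(\<lambda>n. complex_of_real (ml_term lam (2 * n + 1) t)) sums - (?c * J_series lam t)"
    by (simp only: J_term_eq_ml_term[OF assms] minus_minus)
  from I J have "(\<lambda>n. ml_term lam (2 * n) t) sums Re (I_series lam t)"
    and "(\<lambda>n. ml_term lam (2 * n + 1) t) sums Re (- (?c * J_series lam t))"
    by (simp_all only: sums_complex_iff Re_complex_of_real)
  \<comment> \<open>Interleaving two convergent series; \<open>sums_if\<close> takes the odd-indexed
    one first.\<close>
  from sums_if[OF this(2,1)]
  have "(\<lambda>k. if even k then ml_term lam (2 * (k div 2)) t
             else ml_term lam (2 * ((k - 1) div 2) + 1) t)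
         sums (Re (- (?c * J_series lam t)) + Re (I_series lam t))" .
  also have "(\<lambda>k. if even k then ml_term lam (2 * (k div 2)) t
                  else ml_term lam (2 * ((k - 1) div 2) + 1) t) = (\<lambda>k. ml_term lam k t)"
    by (auto simp: fun_eq_iff elim!: evenE oddE)
  finally have S: "(\<lambda>k. ml_term lam k t) sums (Re (- (?c * J_series lam t)) + Re (I_series lam t))" .
  thus "summable (\<lambda>k. ml_term lam k t)"
    by (rule sums_summable)
  \<comment> \<open>All terms are real, so the complex sums are real and the identity of real parts
    lifts to the complex numbers.\<close>
  from I J have "Im (I_series lam t) = 0" "Im (- (?c * J_series lam t)) = 0"
    by (simp_all only: sums_complex_iff Im_complex_of_real)
       (use sums_unique2[OF _ sums_zero] in blast)+
  thus "complex_of_real (ml_series lam t) = I_series lam t - ?c * J_series lam t"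
    using sums_unique[OF S] by (auto simp: ml_series_def complex_eq_iff)
qed

text \<open>The parameter \<open>- \<bar>lam\<bar>\<close> makes all terms nonnegative at
  nonnegative arguments, so the values at \<open>t\<close> form a constant majorant on
  \<open>{0..t}\<close> for the Weierstrass test.\<close>

lemma ml_term_norm_le:
  assumes "0 \<le> x" "x \<le> t"
  shows "norm (ml_term lam k x) \<le> ml_term (- \<bar>lam\<bar>) k t"
proof -
  have "Gamma (3 * real k / 2 + 1) > 0"
    by (intro Gamma_real_pos) (simp add: add_nonneg_pos)
  hence "norm (ml_term lam k x) = \<bar>lam\<bar> ^ k / Gamma (3 * real k / 2 + 1) * sqrt x ^ (3 * k)"
    using assms(1) by (simp add: ml_term_def abs_mult power_abs)
  also have "\<dots> \<le> \<bar>lam\<bar> ^ k / Gamma (3 * real k / 2 + 1) * sqrt t ^ (3 * k)"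
    using assms \<open>Gamma (3 * real k / 2 + 1) > 0\<close>
    by (intro mult_left_mono power_mono) auto
  finally show ?thesis
    by (simp add: ml_term_def)
qed

lemma continuous_on_ml_term: "continuous_on A (ml_term lam k)"
  unfolding ml_term_def by (intro continuous_intros)

section \<open>Existence\<close>

text \<open>This is the Beta integral rescaled from \<open>{0..1}\<close> to \<open>{0..t}\<close>:
  the powers contribute \<open>t powr (a + b - 2)\<close> and the stretch one more factor
  \<open>t\<close>.\<close>

lemma has_integral_Beta_convolution:
  fixes a b t :: real
  assumes "a > 0" "b > 0" "t > 0"
  shows "((\<lambda>x. x powr (a - 1) * (t - x) powr (b - 1)) has_integral t powr (a + b - 1) * Beta a b) {0..t}"
proof -
  from has_integral_stretch_real[OF has_integral_Beta_real[OF assms(1,2)], of "1 / t"] assms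
  have "((\<lambda>x. (x / t) powr (a - 1) * (1 - x / t) powr (b - 1)) has_integral t * Beta a b)
          ((\<lambda>x. x * t) ` {0..1})"
    by simp
  also have "(\<lambda>x. x * t) ` {0..1} = {0..t}"
    using image_mult_atLeastAtMost[of t 0 1] assms by (simp add: mult.commute)
  finally have "((\<lambda>x. t powr (a + b - 2) * ((x / t) powr (a - 1) * (1 - x / t) powr (b - 1)))
                  has_integral t powr (a + b - 2) * (t * Beta a b)) {0..t}"
    by (rule has_integral_mult_right)
  also have "t powr (a + b - 2) * (t * Beta a b) = t powr (a + b - 1) * Beta a b"
    using assms powr_mult_base[of t "a + b - 2"] by (simp add: mult_ac)
  finally show ?thesis
  proof (rule has_integral_eq[rotated])
    fix x assume "x \<in> {0..t}"
    moreover have "1 - x / t = (t - x) / t"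
      using assms by (simp add: field_simps)
    moreover have "t powr (a + b - 2) = t powr (a - 1) * t powr (b - 1)"
      by (simp flip: powr_add)
    ultimately show "t powr (a + b - 2) * ((x / t) powr (a - 1) * (1 - x / t) powr (b - 1))
        = x powr (a - 1) * (t - x) powr (b - 1)"
      using assms by (simp add: powr_divide)
  qed
qed

lemma sqrt_power_eq_powr: "x > 0 \<Longrightarrow> sqrt x ^ n = x powr (real n / 2)"
  by (simp add: powr_half_sqrt[symmetric] powr_powr flip: powr_realpow)

text \<open>In \<open>Beta a (3/2)\<close> the factor \<open>Gamma a\<close> cancels the old
  denominator, \<open>Gamma (a + 3/2)\<close> becomes the new one, and
  \<open>Gamma (3/2) = sqrt pi / 2\<close> cancels the prefactor \<open>2 / sqrt pi\<close>.\<close>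

lemma has_integral_ml_term:
  assumes "t > 0"
  shows "((\<lambda>x. 2 * lam / sqrt pi * (ml_term lam k x * sqrt (t - x)))
           has_integral - ml_term lam (Suc k) t) {0..t}"
proof -
  define a where "a = 3 * real k / 2 + 1"
  let ?C = "2 * lam / sqrt pi * ((- lam) ^ k / Gamma a)"
  have "a > 0"
    by (simp add: a_def add_nonneg_pos)
  hence pos: "Gamma a > 0"
    by (rule Gamma_real_pos)
  have "((\<lambda>x. ?C * (x powr (a - 1) * (t - x) powr (3 / 2 - 1)))
          has_integral ?C * (t powr (a + 3 / 2 - 1) * Beta a (3 / 2))) {0..t}"
    by (intro has_integral_mult_right has_integral_Beta_convolution) (use assms \<open>a > 0\<close> in auto)
  also have "?C * (t powr (a + 3 / 2 - 1) * Beta a (3 / 2)) = - ml_term lam (Suc k) t"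
  proof -
    have "sqrt t ^ (3 * Suc k) = t powr (a + 3 / 2 - 1)"
      using assms by (subst sqrt_power_eq_powr) (auto simp: a_def field_simps)
    moreover have "3 * real (Suc k) / 2 + 1 = a + 3 / 2"
      by (simp add: a_def field_simps)
    ultimately show ?thesis
      using pos by (simp only: ml_term_def Beta_def Gamma_three_halves) simp
  qed
  finally show ?thesis
  \<comment> \<open>The point \<open>0\<close> is excluded because for \<open>k = 0\<close> the
    integrands may differ there: \<open>sqrt 0 ^ 0 = 1\<close> but
    \<open>0 powr 0 = 0\<close>.\<close>
  proof (rule has_integral_spike[OF negligible_sing[of 0], rotated])
    fix x assume "x \<in> {0..t} - {0}"
    moreover have "sqrt x ^ (3 * k) = x powr (a - 1)" if "x > 0"
      using that by (subst sqrt_power_eq_powr) (auto simp: a_def)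
    moreover have "sqrt (t - x) = (t - x) powr (3 / 2 - 1)" if "x \<le> t"
      using that powr_half_sqrt[of "t - x"] by simp
    ultimately show "2 * lam / sqrt pi * (ml_term lam k x * sqrt (t - x))
        = ?C * (x powr (a - 1) * (t - x) powr (3 / 2 - 1))"
      by (simp add: ml_term_def flip: a_def)
  qed
qed

text \<open>Uniform convergence on \<open>{0..t}\<close> allows integration term by term. Each term
  is sent to minus its successor, so the integral is minus the series without its first term, which
  is \<open>1\<close>.\<close>

lemma volterra_solution_ml_series: "volterra_solution lam (ml_series lam)"
  unfolding volterra_solution_def
proof (intro allI impI)
  fix t :: real assume t: "t > 0"
  let ?S = "\<lambda>n x. \<Sum>k<n. ml_term lam k x"
  let ?c = "2 * lam / sqrt pi"
  have unif: "uniform_limit {0..t} ?S (ml_series lam) sequentially"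
    unfolding ml_series_def
    by (rule Weierstrass_m_test[OF _ ml_term_sums(1)[OF t, of "- \<bar>lam\<bar>"]])
       (rule ml_term_norm_le; simp)
  have contS: "continuous_on {0..t} (?S n)" for n
    by (intro continuous_on_sum continuous_on_ml_term)
  have cont: "continuous_on {0..t} (ml_series lam)"
    by (rule uniform_limit_theorem[OF _ unif]) (auto simp: contS)
  have contk: "continuous_on {0..t} (\<lambda>x. sqrt (t - x))"
    by (intro continuous_intros)
  have int: "(\<lambda>x. ml_series lam x * sqrt (t - x)) absolutely_integrable_on {0..t}"
    by (intro absolutely_integrable_continuous_real continuous_on_mult cont contk)
  have bdd: "bounded (f ` {0..t})" if "continuous_on {0..t} f" for f :: "real \<Rightarrow> real"
    using that by (intro compact_imp_bounded compact_continuous_image) auto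
  have "uniform_limit {0..t} (\<lambda>n x. ?c * (?S n x * sqrt (t - x)))
          (\<lambda>x. ?c * (ml_series lam x * sqrt (t - x))) sequentially"
    by (intro uniform_limit_intros unif bounded_linear.uniform_limit[OF bounded_linear_mult_right]
              bounded_bilinear.bounded_uniform_limit[OF bounded_bilinear_mult] bdd cont contk)
  moreover have "continuous_on {0..t} (\<lambda>x. ?c * (?S n x * sqrt (t - x)))" for n
    by (intro continuous_on_mult contS contk continuous_on_const)
  ultimately obtain I J where
    I: "\<And>n. ((\<lambda>x. ?c * (?S n x * sqrt (t - x))) has_integral I n) {0..t}" and
    J: "((\<lambda>x. ?c * (ml_series lam x * sqrt (t - x))) has_integral J) {0..t}" and
    IJ: "I \<longlonglongrightarrow> J"
    by (rule uniform_limit_integral[OF _ _ sequentially_bot]) (rule that)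
  have "I n = (\<Sum>k<n. - ml_term lam (Suc k) t)" for n
  proof (rule has_integral_unique[OF I])
    have "((\<lambda>x. \<Sum>k<n. ?c * (ml_term lam k x * sqrt (t - x)))
            has_integral (\<Sum>k<n. - ml_term lam (Suc k) t)) {0..t}"
      by (intro has_integral_sum has_integral_ml_term t) auto
    thus "((\<lambda>x. ?c * (?S n x * sqrt (t - x)))
            has_integral (\<Sum>k<n. - ml_term lam (Suc k) t)) {0..t}"
      by (simp add: sum_distrib_left sum_distrib_right)
  qed
  hence "I = (\<lambda>n. \<Sum>k<n. - ml_term lam (Suc k) t)"
    by (rule ext)
  with IJ have "(\<lambda>k. - ml_term lam (Suc k) t) sums J"
    by (simp only: sums_def)
  moreover have "(\<lambda>k. - ml_term lam (Suc k) t) sums - (ml_series lam t - ml_term lam 0 t)"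
    unfolding ml_series_def
    by (intro sums_minus, subst sums_Suc_iff)
       (use summable_sums[OF ml_term_sums(1)[OF t, of lam]] in simp)
  ultimately have "J = ml_term lam 0 t - ml_series lam t"
    using sums_unique2 by fastforce
  moreover have "J = ?c * integral {0..t} (\<lambda>x. ml_series lam x * sqrt (t - x))"
    using integral_unique[OF J] by simp
  ultimately show "(\<lambda>x. ml_series lam x * sqrt (t - x)) absolutely_integrable_on {0..t} \<and>
      ml_series lam t = 1 - ?c * integral {0..t} (\<lambda>x. ml_series lam x * sqrt (t - x))"
    using int by (simp add: ml_term_def)
qed

section \<open>Uniqueness\<close>

lemma has_integral_power_fact:
  fixes K t :: real
  assumes "t \<ge> 0"
  shows "((\<lambda>x. K * ((K * x) ^ n / fact n)) has_integral (K * t) ^ Suc n / fact (Suc n)) {0..t}"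
proof -
  have "((\<lambda>x. (K * x) ^ Suc n / fact (Suc n)) has_vector_derivative K * ((K * x) ^ n / fact n))
          (at x within {0..t})" for x
  proof -
    have "((\<lambda>x. (K * x) ^ Suc n / fact (Suc n)) has_real_derivative
            real (Suc n) * (K * (K * x) ^ n) / fact (Suc n)) (at x within {0..t})"
      by (auto intro!: derivative_eq_intros simp del: power_Suc)
    also have "real (Suc n) * (K * (K * x) ^ n) / fact (Suc n) = K * ((K * x) ^ n / fact n)"
      by (simp del: of_nat_Suc)
    finally show ?thesis
      by (simp only: has_real_derivative_iff_has_vector_derivative)
  qed
  from fundamental_theorem_of_calculus[OF assms this] show ?thesis
    by simp
qed

text \<open>Feeding the bound back into the integral inequality raises the power and the factorial
  by one. Since \<open>u\<close> need not be continuous, the iteration starts from the total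
  integral \<open>A\<close> and not from a supremum.\<close>

lemma gronwall_zero:
  fixes u :: "real \<Rightarrow> real"
  assumes K: "K \<ge> 0"
    and int: "(\<lambda>x. \<bar>u x\<bar>) integrable_on {0..T}"
    and le: "\<And>t. 0 < t \<Longrightarrow> t \<le> T \<Longrightarrow> \<bar>u t\<bar> \<le> K * integral {0..t} (\<lambda>x. \<bar>u x\<bar>)"
    and t: "0 < t" "t \<le> T"
  shows "u t = 0"
proof -
  define A where "A = integral {0..T} (\<lambda>x. \<bar>u x\<bar>)"
  have int': "(\<lambda>x. \<bar>u x\<bar>) integrable_on {0..s}" if "s \<le> T" for s
    by (rule integrable_on_subinterval[OF int]) (use that in auto)
  have bound: "\<bar>u s\<bar> \<le> K * A * ((K * s) ^ n / fact n)" if "0 < s" "s \<le> T" for s n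
    using that
  proof (induction n arbitrary: s)
    case 0
    have "integral {0..s} (\<lambda>x. \<bar>u x\<bar>) \<le> A"
      unfolding A_def by (rule integral_subset_le) (use 0 int int' in auto)
    hence "K * integral {0..s} (\<lambda>x. \<bar>u x\<bar>) \<le> K * A"
      using K by (rule mult_left_mono)
    with le[OF 0] show ?case
      by simp
  next
    case (Suc n)
    have "integral {0..s} (\<lambda>x. \<bar>u x\<bar>) \<le> A * ((K * s) ^ Suc n / fact (Suc n))"
    proof (rule has_integral_le)
      \<comment> \<open>The open interval avoids \<open>x = 0\<close>, where the inequality says
        nothing about \<open>u\<close>.\<close>
      show "((\<lambda>x. \<bar>u x\<bar>) has_integral integral {0..s} (\<lambda>x. \<bar>u x\<bar>)) {0<..<s}"
        using int'[OF Suc.prems(2)] by (simp add: integrable_integral flip: has_integral_Icc_iff_Ioo)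
      show "((\<lambda>x. A * (K * ((K * x) ^ n / fact n)))
              has_integral A * ((K * s) ^ Suc n / fact (Suc n))) {0<..<s}"
        unfolding has_integral_Icc_iff_Ioo[symmetric]
        by (intro has_integral_mult_right has_integral_power_fact) (use Suc.prems in auto)
      show "\<bar>u x\<bar> \<le> A * (K * ((K * x) ^ n / fact n))" if "x \<in> {0<..<s}" for x
        using Suc.IH[of x] that Suc.prems by (simp add: mult_ac)
    qed
    hence "K * integral {0..s} (\<lambda>x. \<bar>u x\<bar>) \<le> K * (A * ((K * s) ^ Suc n / fact (Suc n)))"
      using K by (rule mult_left_mono)
    with le[OF Suc.prems] show ?case
      by (simp only: mult.assoc)
  qed
  have "(\<lambda>n. K * A * (inverse (fact n) * (K * t) ^ n)) \<longlonglongrightarrow> K * A * 0"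
    by (intro tendsto_intros summable_LIMSEQ_zero summable_exp)
  hence "\<bar>u t\<bar> \<le> K * A * 0"
    by (rule LIMSEQ_le_const) (use bound[OF t] in \<open>auto simp: inverse_eq_divide\<close>)
  thus ?thesis by simp
qed

lemma volterra_homogeneous_zero:
  fixes u :: "real \<Rightarrow> real"
  assumes int: "\<And>t. t > 0 \<Longrightarrow> (\<lambda>x. u x * sqrt (t - x)) absolutely_integrable_on {0..t}"
    and eq: "\<And>t. t > 0 \<Longrightarrow> u t = c * integral {0..t} (\<lambda>x. u x * sqrt (t - x))"
    and T: "T > 0"
  shows "u T = 0"
proof -
  \<comment> \<open>Integrability of \<open>u\<close> itself needs the hypothesis at a later time, since \<open>sqrt (T - x)\<close>
    vanishes at \<open>x = T\<close>.\<close>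
  have cont: "continuous_on {0..T} (\<lambda>x. 1 / sqrt (2 * T - x))"
    by (intro continuous_intros) (use T in auto)
  have "(\<lambda>x. 1 / sqrt (2 * T - x) * (u x * sqrt (2 * T - x))) absolutely_integrable_on {0..T}"
  proof (rule absolutely_integrable_bounded_measurable_product_real)
    show "(\<lambda>x. 1 / sqrt (2 * T - x)) \<in> borel_measurable (lebesgue_on {0..T})"
      by (rule continuous_imp_measurable_on_sets_lebesgue[OF cont]) auto
    show "bounded ((\<lambda>x. 1 / sqrt (2 * T - x)) ` {0..T})"
      by (intro compact_imp_bounded compact_continuous_image cont) auto
    show "(\<lambda>x. u x * sqrt (2 * T - x)) absolutely_integrable_on {0..T}"
      by (rule absolutely_integrable_on_subinterval[OF int]) (use T in auto)
  qed auto
  hence absint: "u absolutely_integrable_on {0..T}"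
    by (rule absolutely_integrable_spike[OF _ negligible_empty]) (use T in auto)
  hence iu: "(\<lambda>x. \<bar>u x\<bar>) integrable_on {0..T}"
    by (simp add: absolutely_integrable_on_def)
  show ?thesis
  \<comment> \<open>The kernel satisfies \<open>sqrt (t - x) \<le> sqrt T\<close> for
    \<open>0 \<le> x \<le> t \<le> T\<close>, which gives the constant.\<close>
  proof (rule gronwall_zero[OF _ iu, of "\<bar>c\<bar> * sqrt T"])
    fix t assume t: "0 < t" "t \<le> T"
    have iut: "(\<lambda>x. \<bar>u x\<bar>) integrable_on {0..t}"
      by (rule integrable_on_subinterval[OF iu]) (use t in auto)
    have "norm (integral {0..t} (\<lambda>x. u x * sqrt (t - x))) \<le> integral {0..t} (\<lambda>x. sqrt T * \<bar>u x\<bar>)"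
    proof (rule integral_norm_bound_integral)
      show "(\<lambda>x. u x * sqrt (t - x)) integrable_on {0..t}"
        using int[OF t(1)] by (simp add: absolutely_integrable_on_def)
      show "(\<lambda>x. sqrt T * \<bar>u x\<bar>) integrable_on {0..t}"
        by (intro integrable_on_mult_right iut)
      show "norm (u x * sqrt (t - x)) \<le> sqrt T * \<bar>u x\<bar>" if "x \<in> {0..t}" for x
        using that t by (auto simp: abs_mult mult.commute[of "sqrt T"] intro!: mult_left_mono)
    qed
    hence "\<bar>c\<bar> * \<bar>integral {0..t} (\<lambda>x. u x * sqrt (t - x))\<bar> \<le>
             \<bar>c\<bar> * (sqrt T * integral {0..t} (\<lambda>x. \<bar>u x\<bar>))"
      by (intro mult_left_mono) simp_all
    thus "\<bar>u t\<bar> \<le> \<bar>c\<bar> * sqrt T * integral {0..t} (\<lambda>x. \<bar>u x\<bar>)"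
      unfolding eq[OF t(1)] by (simp only: abs_mult mult.assoc)
  qed (use T in auto)
qed

text \<open>The constant \<open>1\<close> cancels in the difference of two solutions, which
  therefore solves the homogeneous equation.\<close>

lemma volterra_solution_unique:
  assumes "volterra_solution lam y" "volterra_solution lam z" "t > 0"
  shows "y t = z t"
proof -
  let ?c = "2 * lam / sqrt pi"
  have y: "(\<lambda>x. y x * sqrt (t - x)) absolutely_integrable_on {0..t}"
          "y t = 1 - ?c * integral {0..t} (\<lambda>x. y x * sqrt (t - x))" if "t > 0" for t
    using assms(1) that unfolding volterra_solution_def by blast+
  have z: "(\<lambda>x. z x * sqrt (t - x)) absolutely_integrable_on {0..t}"
          "z t = 1 - ?c * integral {0..t} (\<lambda>x. z x * sqrt (t - x))" if "t > 0" for t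
    using assms(2) that unfolding volterra_solution_def by blast+
  have "y t - z t = 0"
  proof (rule volterra_homogeneous_zero[where u = "\<lambda>x. y x - z x" and c = "- ?c", OF _ _ assms(3)])
    fix s :: real assume s: "s > 0"
    show "(\<lambda>x. (y x - z x) * sqrt (s - x)) absolutely_integrable_on {0..s}"
      unfolding left_diff_distrib using y(1)[OF s] z(1)[OF s]
      by (rule set_integral_diff(1))
    have *: "integral {0..s} (\<lambda>x. (y x - z x) * sqrt (s - x)) =
        integral {0..s} (\<lambda>x. y x * sqrt (s - x)) - integral {0..s} (\<lambda>x. z x * sqrt (s - x))"
      unfolding left_diff_distrib using y(1)[OF s] z(1)[OF s]
      by (intro integral_diff) (auto simp: absolutely_integrable_on_def)
    show "y s - z s = - ?c * integral {0..s} (\<lambda>x. (y x - z x) * sqrt (s - x))"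
      unfolding * using y(2)[OF s] z(2)[OF s] by (simp add: right_diff_distrib diff_divide_distrib)
  qed
  thus ?thesis by simp
qed

text \<open>The integral starts at \<open>0\<close>, where \<open>y\<close> and \<open>z\<close> may
  disagree, but a single point is negligible. This gives the direction from the formula on positive
  times back to the equation.\<close>

lemma volterra_solution_cong:
  assumes "\<And>t. t > 0 \<Longrightarrow> y t = z t" "volterra_solution lam z"
  shows "volterra_solution lam y"
  unfolding volterra_solution_def
proof (intro allI impI)
  fix t :: real assume t: "t > 0"
  have eq: "y x * sqrt (t - x) = z x * sqrt (t - x)" if "x \<in> {0..t} - {0}" for x
    using assms(1) that by simp
  have "integral {0..t} (\<lambda>x. z x * sqrt (t - x)) = integral {0..t} (\<lambda>x. y x * sqrt (t - x))"
    by (rule integral_spike[OF negligible_sing[of 0] eq])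
  moreover have int: "(\<lambda>x. z x * sqrt (t - x)) absolutely_integrable_on {0..t}"
    and "z t = 1 - 2 * lam / sqrt pi * integral {0..t} (\<lambda>x. z x * sqrt (t - x))"
    using assms(2) t unfolding volterra_solution_def by blast+
  moreover have "(\<lambda>x. y x * sqrt (t - x)) absolutely_integrable_on {0..t}"
    by (rule absolutely_integrable_spike[OF int negligible_sing[of 0] eq])
  ultimately show "(\<lambda>x. y x * sqrt (t - x)) absolutely_integrable_on {0..t} \<and>
      y t = 1 - 2 * lam / sqrt pi * integral {0..t} (\<lambda>x. y x * sqrt (t - x))"
    using assms(1)[OF t] by simp
qed

theorem theorem2p3:
  fixes lam :: real
  shows "(\<exists>y. volterra_solution lam y) \<and>
         (\<forall>y. volterra_solution lam y \<longleftrightarrow>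
            (\<forall>t>0. complex_of_real (y t) =
                     I_series lam t - complex_of_real (sqrt (2 / pi)) * J_series lam t)) \<and>
         (\<forall>t>0. summable (I_term lam t) \<and> summable (J_term lam t)) \<and>
         conv_radius (I_coeff lam) = \<infinity> \<and> conv_radius (J_coeff lam) = \<infinity>"
proof -
  have "volterra_solution lam y \<longleftrightarrow> (\<forall>t>0. y t = ml_series lam t)" for y
    using volterra_solution_unique volterra_solution_cong volterra_solution_ml_series by metis
  moreover have "y t = ml_series lam t \<longleftrightarrow> complex_of_real (y t) =
      I_series lam t - complex_of_real (sqrt (2 / pi)) * J_series lam t" if "t > 0" for y t
    by (simp flip: ml_term_sums(2)[OF that])
  ultimately show ?thesis
    using volterra_solution_ml_series summable_I_term summable_J_term
      conv_radius_I_coeff conv_radius_J_coeff by auto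
qed

end
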